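(* Let $\lambda>0$ and $\eta\in\mathbb{D}$. For any $s\in\mathbb{N}$ and $c\in\mathbb{R}^+$, the following results hold. (a) $p_1(z)\in\Omega_{\mathcal{H}}^0(\lambda)$, if $\Gamma(c)\Gamma(c+2s)<\lambda\left(\Gamma(c+s)\right)^2$. (b) $p_2(z)\in\Omega_{\mathcal{H}}^0(\lambda)$, if $s^2\,\Gamma(c)\Gamma(c+2s)<\lambda(c+2s-1)\left(\Gamma(c+s)\right)^2$. (c) $p_3(z)\in\Omega_{\mathcal{H}}^0(\lambda)$, if $(c+s^2+2s-1)\,\Gamma(c)\Gamma(c+2s)<\lambda(c+2s-1)\left(\Gamma(c+s)\right)^2$. Here, $p_1(z)$, $p_2(z)$ and $p_3(z)$ are harmonic univalent polynomials, given by $$p_1(z)=z+\overline{\eta\sum_{n=0}^s\binom{s}{n}\frac{(s-n+1)_n}{(c)_n}\,\frac{z^{n+2}}{n+1}},$$ $$p_2(z)=z+\overline{\eta\sum_{n=0}^s\binom{s}{n}\frac{(s-n+1)_n}{(c)_n}\,z^{n+1}},$$ $$p_3(z)=z+\overline{\eta\sum_{n=0}^s\binom{s}{n}\frac{(s-n+1)_n}{(c)_n}\,z^{n+2}}.$$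
   Context: $\mathbb{D}=\{z\in\mathbb{C}:|z|<1\}$, and $\mathbb{R}^+$ is the set of positive real numbers. $(x)_n=x(x+1)\cdots(x+n-1)$ for $n\in\mathbb{N}$, with $(x)_0=1$, is the Pochhammer symbol; $\Gamma$ is the Gamma function; univalent means injective. $\mathcal{H}^0$ is the class of complex-valued harmonic functions $f=h+\overline{g}$ on $\mathbb{D}$, where $h,g$ are analytic on $\mathbb{D}$ with $h(z)=z+\sum_{n\ge2}a_nz^n$ and $g(z)=\sum_{n\ge2}b_nz^n$. For $\lambda>0$, $\Omega_{\mathcal{H}}^0(\lambda)$ is the set of $f=h+\overline{g}\in\mathcal{H}^0$ such that $|h(z)-zh'(z)|<\lambda-|g(z)-zg'(z)|$ for all $z\in\mathbb{D}$.
   Formalization: In (b), p_2 has b_1=η, so for η≠0 it is not in H^0: shown instead are p_2 in the class with b_1 free, and p_2 minus its n=0 term in Ω_H^0(λ). Univalence fails in general; shown only if 2λ|η|≤1 ((1+2λ)|η|≤1 for p_2). ℕ starts at 1. *)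

theory Defs
  imports "HOL-Complex_Analysis.Complex_Analysis"
begin

abbreviation unit_disc :: "complex set" ("\<D>")
  where "\<D> \<equiv> ball 0 1"

text \<open>
  \<open>harmonic_decomp m f h g\<close>: on the unit disc, \<open>f = h + cnj g\<close> with \<open>h\<close>, \<open>g\<close> analytic there,
  \<open>h z = z + (\<Sum>n\<ge>2. a\<^sub>n z^n)\<close> and \<open>g z = (\<Sum>n\<ge>m. b\<^sub>n z^n)\<close>.  For \<open>m = 2\<close> this is the
  normalisation of the class \<open>\<H>\<^sup>0\<close>; for \<open>m = 1\<close> a linear term in \<open>g\<close> is allowed.
  Functions are total in HOL; only their values on the disc matter.
\<close>

definition harmonic_decomp ::
  "nat \<Rightarrow> (complex \<Rightarrow> complex) \<Rightarrow> (complex \<Rightarrow> complex) \<Rightarrow> (complex \<Rightarrow> complex) \<Rightarrow> bool" where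
  "harmonic_decomp m f h g \<longleftrightarrow>
     h analytic_on \<D> \<and> g analytic_on \<D> \<and>
     (\<exists>a. \<forall>z\<in>\<D>. (\<lambda>n. a (n + 2) * z ^ (n + 2)) sums (h z - z)) \<and>
     (\<exists>b. \<forall>z\<in>\<D>. (\<lambda>n. b (n + m) * z ^ (n + m)) sums g z) \<and>
     (\<forall>z\<in>\<D>. f z = h z + cnj (g z))"

definition Omega_inequality ::
  "real \<Rightarrow> (complex \<Rightarrow> complex) \<Rightarrow> (complex \<Rightarrow> complex) \<Rightarrow> bool" where
  "Omega_inequality lam h g \<longleftrightarrow>
     (\<forall>z\<in>\<D>. norm (h z - z * deriv h z) < lam - norm (g z - z * deriv g z))"

definition Omega_H0 :: "real \<Rightarrow> (complex \<Rightarrow> complex) set" where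
  "Omega_H0 lam = {f. \<exists>h g. harmonic_decomp 2 f h g \<and> Omega_inequality lam h g}"

text \<open>
  The same class without the requirement that the linear coefficient of \<open>g\<close> vanish.
\<close>

definition Omega_H :: "real \<Rightarrow> (complex \<Rightarrow> complex) set" where
  "Omega_H lam = {f. \<exists>h g. harmonic_decomp 1 f h g \<and> Omega_inequality lam h g}"

definition p_coeff :: "nat \<Rightarrow> real \<Rightarrow> nat \<Rightarrow> real" where
  "p_coeff s c n =
     real (s choose n) * (pochhammer (real s - real n + 1) n / pochhammer c n)"

definition p1 :: "nat \<Rightarrow> real \<Rightarrow> complex \<Rightarrow> complex \<Rightarrow> complex" where
  "p1 s c \<eta> z =
     z + cnj (\<eta> * (\<Sum>n=0..s. of_real (p_coeff s c n) * (z ^ (n + 2) / of_nat (n + 1))))"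

definition p2 :: "nat \<Rightarrow> real \<Rightarrow> complex \<Rightarrow> complex \<Rightarrow> complex" where
  "p2 s c \<eta> z = z + cnj (\<eta> * (\<Sum>n=0..s. of_real (p_coeff s c n) * z ^ (n + 1)))"

text \<open>
  The \<open>n = 0\<close> term of \<open>p2\<close> contributes \<open>cnj (\<eta> * z)\<close>, so for \<open>\<eta> \<noteq> 0\<close> the polynomial \<open>p2\<close>
  has \<open>b\<^sub>1 = \<eta> \<noteq> 0\<close> and lies outside \<open>\<H>\<^sup>0\<close>.  \<open>p2_normalized\<close> is \<open>p2\<close> with that term removed.
\<close>

definition p2_normalized :: "nat \<Rightarrow> real \<Rightarrow> complex \<Rightarrow> complex \<Rightarrow> complex" where
  "p2_normalized s c \<eta> z =
     z + cnj (\<eta> * (\<Sum>n=1..s. of_real (p_coeff s c n) * z ^ (n + 1)))"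

definition p3 :: "nat \<Rightarrow> real \<Rightarrow> complex \<Rightarrow> complex \<Rightarrow> complex" where
  "p3 s c \<eta> z = z + cnj (\<eta> * (\<Sum>n=0..s. of_real (p_coeff s c n) * z ^ (n + 2)))"

end

theory Submission
  imports Defs
begin

text \<open>
  The coefficients are those of \<open>\<^sub>2F\<^sub>1(-s, -s; c; z)\<close>, so their sum is given by the
  Chu--Vandermonde identity, and the sum weighted by \<open>n\<close> reduces to the same identity with
  \<open>(s, c)\<close> replaced by \<open>(s - 1, c + 1)\<close>. Membership in the class is then the triangle inequality
  for \<open>g - z g'\<close>. The polynomial \<open>z + cnj (g z)\<close> is injective because \<open>g\<close> is a strict
  contraction as soon as \<open>\<Sum>k \<bar>b\<^sub>k\<bar> < 1\<close>, and \<open>k \<le> 2 (k - 1)\<close> for \<open>k \<ge> 2\<close> compares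
  this sum with the one controlling membership.
\<close>

section \<open>Hypergeometric sums\<close>

lemma pochhammer_falling:
  "pochhammer (real s - real n + 1) n = fact n * real (s choose n)"
  by (simp add: gbinomial_pochhammer' binomial_gbinomial)

text \<open>Since (-s)_n = (-1)^n n! C(s,n), this is ((-s)_n)^2 / ((c)_n n!), the coefficient of z^n
  in 2F1(-s,-s;c;z).\<close>

lemma p_coeff_eq:
  "p_coeff s c n = (real (s choose n))\<^sup>2 * fact n / pochhammer c n"
  by (simp add: p_coeff_def pochhammer_falling power2_eq_square)

lemma p_coeff_0 [simp]: "p_coeff s c 0 = 1"
  by (simp add: p_coeff_def)

lemma p_coeff_nonneg:
  assumes "c > 0"
  shows "p_coeff s c n \<ge> 0"
  using assms by (simp add: p_coeff_eq pochhammer_pos less_imp_le)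

text \<open>Scaling by (c)_s / s! turns each term into a product of binomials with lower indices n
  and s - n, so the sum becomes a Vandermonde convolution.\<close>

lemma sum_p_coeff_pochhammer:
  assumes "c > 0"
  shows "(\<Sum>n=0..s. p_coeff s c n) = pochhammer (c + real s) s / pochhammer c s"
proof -
  have pos: "pochhammer c n > 0" for n
    using assms by (rule pochhammer_pos)
  have term_eq: "p_coeff s c n =
      (real s gchoose n) * ((c + real s - 1) gchoose (s - n)) * fact s / pochhammer c s"
    if n: "n \<le> s" for n
  proof -
    have split: "pochhammer c s = pochhammer c n * pochhammer (c + real n) (s - n)"
      using n by (rule pochhammer_product)
    \<comment> \<open>The lowest factor is c+s-1-(s-n)+1 = c+n, so the numerator is what remains of
      \<open>pochhammer c s\<close> after \<open>pochhammer c n\<close>.\<close>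
    have g: "(c + real s - 1) gchoose (s - n) = pochhammer (c + real n) (s - n) / fact (s - n)"
      using n by (simp add: gbinomial_pochhammer' of_nat_diff algebra_simps)
    have f: "(fact s :: real) = fact n * fact (s - n) * real (s choose n)"
      using binomial_fact_lemma[OF n] by (metis of_nat_fact of_nat_mult)
    have nz: "pochhammer (c + real n) (s - n) \<noteq> 0"
      using assms by (metis add_pos_nonneg less_irrefl of_nat_0_le_iff pochhammer_pos)
    show ?thesis
      using pos[of n] nz unfolding p_coeff_eq g split f
      by (simp add: binomial_gbinomial[symmetric] power2_eq_square)
  qed
  have "(\<Sum>n=0..s. p_coeff s c n) =
      (\<Sum>n=0..s. (real s gchoose n) * ((c + real s - 1) gchoose (s - n))) * fact s / pochhammer c s"
    unfolding sum_distrib_right sum_divide_distrib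
    by (intro sum.cong refl term_eq) auto
  also have "\<dots> = ((real s + (c + real s - 1)) gchoose s) * fact s / pochhammer c s"
    by (simp only: gbinomial_Vandermonde)
  also have "\<dots> = pochhammer (c + real s) s / pochhammer c s"
    by (simp add: gbinomial_pochhammer' algebra_simps)
  finally show ?thesis .
qed

lemma sum_p_coeff:
  assumes "c > 0"
  shows "(\<Sum>n=0..s. p_coeff s c n) = Gamma c * Gamma (c + 2 * real s) / (Gamma (c + real s))\<^sup>2"
proof -
  have "pochhammer x s = Gamma (x + real s) / Gamma x" if "x > 0" for x :: real
    using that by (intro pochhammer_Gamma) (auto elim: nonpos_Ints_cases)
  from this[of c] this[of "c + real s"] show ?thesis
    using assms unfolding sum_p_coeff_pochhammer[OF assms]
    by (simp add: power2_eq_square algebra_simps)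
qed

text \<open>Coefficient form of F' = (ab/c) F(a+1,b+1;c+1) for a = b = -s-1. Absorption in the
  binomial is used twice: one factor n+1 is explicit, the other comes from (n+1)!.\<close>

lemma p_coeff_Suc:
  assumes "c > 0"
  shows "real (Suc n) * p_coeff (Suc s) c (Suc n) = (real (Suc s))\<^sup>2 / c * p_coeff s (c + 1) n"
proof -
  have b: "real (Suc n) * real (Suc s choose Suc n) = real (Suc s) * real (s choose n)"
    by (metis Suc_times_binomial_eq mult.commute of_nat_mult)
  have "real (Suc n) * p_coeff (Suc s) c (Suc n) =
      (real (Suc n) * real (Suc s choose Suc n))\<^sup>2 * fact n / (c * pochhammer (c + 1) n)"
    using assms by (simp add: p_coeff_eq pochhammer_rec power2_eq_square del: binomial_Suc_Suc)
  also have "\<dots> = (real (Suc s))\<^sup>2 / c * p_coeff s (c + 1) n"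
    unfolding b using assms by (simp add: p_coeff_eq power_mult_distrib)
  finally show ?thesis .
qed

lemma sum_index_p_coeff:
  assumes "c > 0" "s \<ge> 1"
  shows "(\<Sum>n=0..s. real n * p_coeff s c n) =
    (real s)\<^sup>2 * Gamma c * Gamma (c + 2 * real s) / ((c + 2 * real s - 1) * (Gamma (c + real s))\<^sup>2)"
proof -
  obtain t where t: "s = Suc t"
    using assms by (cases s) auto
  have "(\<Sum>n=0..s. real n * p_coeff s c n) =
      (\<Sum>n=0..t. real (Suc n) * p_coeff (Suc t) c (Suc n))"
    unfolding t by (subst sum.atLeast0_atMost_Suc_shift) simp
  also have "\<dots> = (real s)\<^sup>2 / c * (\<Sum>n=0..t. p_coeff t (c + 1) n)"
    unfolding sum_distrib_left t by (intro sum.cong refl p_coeff_Suc) (use assms in auto)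
  \<comment> \<open>Here (c+1)+(s-1) = c+s and (c+1)+2(s-1) = c+2s-1, so one step of the Gamma
    recursion at c and at c+2s-1 restores the original arguments.\<close>
  also have "\<dots> = (real s)\<^sup>2 / c * (Gamma (c + 1) * Gamma (c + 2 * real s - 1) / (Gamma (c + real s))\<^sup>2)"
    using assms by (simp add: sum_p_coeff t algebra_simps)
  also have "Gamma (c + 1) = c * Gamma c"
    using assms by (intro Gamma_plus1) (auto elim: nonpos_Ints_cases)
  also have "Gamma (c + 2 * real s - 1) = Gamma (c + 2 * real s) / (c + 2 * real s - 1)"
  proof -
    have "c + 2 * real s - 1 > 0"
      using assms by simp
    moreover from this have "c + 2 * real s - 1 \<notin> \<int>\<^sub>\<le>\<^sub>0"
      by (auto elim!: nonpos_Ints_cases)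
    ultimately show ?thesis
      using Gamma_plus1[of "c + 2 * real s - 1"] by (simp add: field_simps)
  qed
  finally show ?thesis
    using assms by simp
qed

section \<open>Harmonic polynomials with identity analytic part\<close>

lemma deriv_poly_sum:
  fixes b :: "nat \<Rightarrow> complex"
  shows "((\<lambda>z. \<Sum>n=0..N. b n * z ^ (n + m)) has_field_derivative
    (\<Sum>n=0..N. b n * (of_nat (n + m) * z ^ (n + m - 1)))) (at z within S)"
  by (auto intro!: derivative_eq_intros sum.cong)

text \<open>The exponents are free because both g - z g' and g' are estimated this way, and their
  exponents differ by one.\<close>

lemma norm_scaled_power_sum_le:
  fixes b :: "nat \<Rightarrow> complex"
  assumes "norm z \<le> 1"
  shows "norm (\<Sum>n=0..N. b n * z ^ e n) \<le> (\<Sum>n=0..N. norm (b n))"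
  using assms by (intro sum_norm_le) (simp add: norm_mult norm_power mult_left_le power_le_one)

lemma harmonic_decomp_poly:
  assumes "\<And>z. f z = z + cnj (\<Sum>n=0..N. b n * z ^ (n + m))"
  shows "harmonic_decomp m f (\<lambda>z. z) (\<lambda>z. \<Sum>n=0..N. b n * z ^ (n + m))"
  unfolding harmonic_decomp_def
proof (intro conjI)
  show "\<exists>a. \<forall>z\<in>\<D>. (\<lambda>n. a (n + 2) * z ^ (n + 2)) sums (z - z)"
    by (intro exI[of _ "\<lambda>_. 0"]) simp
  \<comment> \<open>The coefficients are extended by zero beyond N; \<open>k - m\<close> undoes the
    shift by m in the power series.\<close>
  let ?b = "\<lambda>k. if k - m \<le> N then b (k - m) else 0"
  have "(\<lambda>n. ?b (n + m) * z ^ (n + m)) sums (\<Sum>n=0..N. b n * z ^ (n + m))" for z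
  proof -
    have "(\<lambda>n. ?b (n + m) * z ^ (n + m)) sums (\<Sum>n=0..N. ?b (n + m) * z ^ (n + m))"
      by (rule sums_finite) auto
    then show ?thesis
      by simp
  qed
  then show "\<exists>b'. \<forall>z\<in>\<D>. (\<lambda>n. b' (n + m) * z ^ (n + m)) sums (\<Sum>n=0..N. b n * z ^ (n + m))"
    by (intro exI[of _ ?b]) blast
qed (use assms in \<open>auto intro!: analytic_intros\<close>)

text \<open>With h the identity, h - z h' vanishes. As z d/dz multiplies z^k by k, the coefficients
  of g - z g' carry the weight k - 1 up to sign.\<close>

lemma Omega_inequality_poly:
  assumes "m \<ge> 1" "(\<Sum>n=0..N. norm (b n) * real (n + m - 1)) < lam"
  shows "Omega_inequality lam (\<lambda>z. z) (\<lambda>z. \<Sum>n=0..N. b n * z ^ (n + m))"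
  unfolding Omega_inequality_def
proof
  fix z :: complex
  assume z: "z \<in> \<D>"
  let ?g = "\<lambda>z. \<Sum>n=0..N. b n * z ^ (n + m)"
  have d: "deriv ?g z = (\<Sum>n=0..N. b n * (of_nat (n + m) * z ^ (n + m - 1)))"
    by (intro DERIV_imp_deriv deriv_poly_sum)
  have "?g z - z * deriv ?g z = (\<Sum>n=0..N. (- b n * of_nat (n + m - 1)) * z ^ (n + m))"
    unfolding d sum_distrib_left sum_subtractf[symmetric]
  proof (intro sum.cong refl)
    fix n
    \<comment> \<open>As m \<ge> 1, the truncated subtraction in \<open>n + m - 1\<close> is
      exact.\<close>
    obtain k where "n + m = Suc k"
      using \<open>m \<ge> 1\<close> by (metis Suc_le_D add_Suc_right One_nat_def)
    then show "b n * z ^ (n + m) - z * (b n * (of_nat (n + m) * z ^ (n + m - 1))) =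
        - b n * of_nat (n + m - 1) * z ^ (n + m)"
      by (simp add: algebra_simps)
  qed
  also have "norm \<dots> \<le> (\<Sum>n=0..N. norm (- b n * of_nat (n + m - 1)))"
    using z by (intro norm_scaled_power_sum_le) simp
  also have "\<dots> < lam"
    using assms(2) by (simp only: norm_mult norm_minus_cancel norm_of_nat)
  finally show "norm (z - z * deriv (\<lambda>z. z) z) < lam - norm (?g z - z * deriv ?g z)"
    by simp
qed

text \<open>If f z = f w then |z - w| = |g z - g w|, because conjugation is isometric. The weighted
  sum bounds |g'| on the convex disc, so the mean value inequality contradicts this.\<close>

lemma inj_on_harmonic_poly:
  assumes "\<And>z. f z = z + cnj (\<Sum>n=0..N. b n * z ^ (n + m))"
    and small: "(\<Sum>n=0..N. norm (b n) * real (n + m)) < 1"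
  shows "inj_on f \<D>"
proof (rule inj_onI, rule ccontr)
  fix z w
  assume zw: "z \<in> \<D>" "w \<in> \<D>" "f z = f w" "z \<noteq> w"
  let ?g = "\<lambda>z. \<Sum>n=0..N. b n * z ^ (n + m)"
  let ?B = "\<Sum>n=0..N. norm (b n) * real (n + m)"
  have "norm (?g z - ?g w) \<le> ?B * norm (z - w)"
  proof (rule field_differentiable_bound[of \<D>])
    show "(?g has_field_derivative (\<Sum>n=0..N. b n * (of_nat (n + m) * u ^ (n + m - 1))))
        (at u within \<D>)" for u
      by (rule deriv_poly_sum)
    fix u :: complex
    assume "u \<in> \<D>"
    then have "norm (\<Sum>n=0..N. (b n * of_nat (n + m)) * u ^ (n + m - 1)) \<le>
        (\<Sum>n=0..N. norm (b n * of_nat (n + m)))"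
      by (intro norm_scaled_power_sum_le) simp
    then show "norm (\<Sum>n=0..N. b n * (of_nat (n + m) * u ^ (n + m - 1))) \<le> ?B"
      by (simp only: mult.assoc norm_mult norm_of_nat)
  qed (use zw in auto)
  also have "\<dots> < norm (z - w)"
    using small zw(4) mult_strict_right_mono[of ?B 1 "norm (z - w)"] by simp
  also have "z - w = cnj (?g w - ?g z)"
    using zw(3) unfolding assms(1) complex_cnj_diff by (simp add: algebra_simps)
  then have "norm (z - w) = norm (?g z - ?g w)"
    by (simp only: complex_mod_cnj norm_minus_commute)
  finally show False
    by simp
qed

text \<open>Gives a contraction constant strictly below 1 from a non-strict condition on |\<eta>|.
  Multiplication by t loses strictness at t = 0, which is the case \<eta> = 0.\<close>

lemma mult_lt_one_of_less:
  assumes "r < (y :: real)" "t * y \<le> 1" "0 \<le> t"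
  shows "t * r < 1"
proof (cases "t = 0")
  case False
  then have "t * r < t * y"
    using assms by (intro mult_strict_left_mono) auto
  with assms show ?thesis
    by linarith
qed simp

text \<open>Common form of all the polynomials considered. Membership only uses |\<eta>| < 1,
  whereas injectivity keeps the factor |\<eta>|, since the bound L may exceed 1.\<close>

lemma harmonic_poly_class_and_inj:
  fixes w :: "nat \<Rightarrow> real"
  assumes f: "\<And>z. f z = z + cnj (\<eta> * (\<Sum>n=0..N. of_real (w n) * z ^ (n + m)))"
    and w: "\<And>n. w n \<ge> 0" and "m \<ge> 1" "norm \<eta> < 1"
    and lam: "(\<Sum>n=0..N. w n * real (n + m - 1)) < lam"
  shows "\<exists>h g. harmonic_decomp m f h g \<and> Omega_inequality lam h g"
    and "(\<Sum>n=0..N. w n * real (n + m)) < L \<Longrightarrow> L * norm \<eta> \<le> 1 \<Longrightarrow> inj_on f \<D>"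
proof -
  define b where "b = (\<lambda>n. \<eta> * of_real (w n))"
  have f': "f z = z + cnj (\<Sum>n=0..N. b n * z ^ (n + m))" for z
    unfolding f b_def sum_distrib_left by (simp add: mult.assoc)
  have nb: "(\<Sum>n=0..N. norm (b n) * v n) = norm \<eta> * (\<Sum>n=0..N. w n * v n)" for v
    unfolding b_def sum_distrib_left using w by (intro sum.cong) (auto simp: norm_mult)
  have "norm \<eta> * (\<Sum>n=0..N. w n * real (n + m - 1)) \<le> (\<Sum>n=0..N. w n * real (n + m - 1))"
    using w \<open>norm \<eta> < 1\<close> by (intro mult_left_le_one_le sum_nonneg) auto
  then have "Omega_inequality lam (\<lambda>z. z) (\<lambda>z. \<Sum>n=0..N. b n * z ^ (n + m))"
    using lam \<open>m \<ge> 1\<close> by (intro Omega_inequality_poly) (auto simp only: nb)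
  with harmonic_decomp_poly[OF f'] show "\<exists>h g. harmonic_decomp m f h g \<and> Omega_inequality lam h g"
    by blast
  show "inj_on f \<D>" if "(\<Sum>n=0..N. w n * real (n + m)) < L" "L * norm \<eta> \<le> 1"
    using that(2) mult_lt_one_of_less[OF that(1), of "norm \<eta>"]
    by (intro inj_on_harmonic_poly[OF f']) (simp_all only: nb mult.commute norm_ge_zero)
qed

text \<open>With A_n the coefficients, S their sum and T the sum of n A_n, the three hypotheses
  amount to S < lam, T < lam and S + T < lam. The factor 2 lam in the univalence conditions comes
  from k \<le> 2 (k - 1).\<close>

theorem theorem2p9:
  fixes lam c :: real and \<eta> :: complex and s :: nat
  assumes "lam > 0" and "\<eta> \<in> \<D>" and "s \<ge> 1" and "c > 0"
  shows
    "(Gamma c * Gamma (c + 2 * real s) < lam * (Gamma (c + real s))\<^sup>2 \<longrightarrow>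
        p1 s c \<eta> \<in> Omega_H0 lam \<and>
        (2 * lam * norm \<eta> \<le> 1 \<longrightarrow> inj_on (p1 s c \<eta>) \<D>)) \<and>
     ((real s)\<^sup>2 * Gamma c * Gamma (c + 2 * real s)
          < lam * (c + 2 * real s - 1) * (Gamma (c + real s))\<^sup>2 \<longrightarrow>
        p2 s c \<eta> \<in> Omega_H lam \<and>
        p2_normalized s c \<eta> \<in> Omega_H0 lam \<and>
        ((1 + 2 * lam) * norm \<eta> \<le> 1 \<longrightarrow> inj_on (p2 s c \<eta>) \<D>) \<and>
        (2 * lam * norm \<eta> \<le> 1 \<longrightarrow> inj_on (p2_normalized s c \<eta>) \<D>)) \<and>
     ((c + (real s)\<^sup>2 + 2 * real s - 1) * Gamma c * Gamma (c + 2 * real s)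
          < lam * (c + 2 * real s - 1) * (Gamma (c + real s))\<^sup>2 \<longrightarrow>
        p3 s c \<eta> \<in> Omega_H0 lam \<and>
        (2 * lam * norm \<eta> \<le> 1 \<longrightarrow> inj_on (p3 s c \<eta>) \<D>))"
proof (intro conjI impI)
  have \<eta>: "norm \<eta> < 1"
    using assms by simp
  let ?A = "p_coeff s c"
  have A: "?A n \<ge> 0" for n
    using \<open>c > 0\<close> by (rule p_coeff_nonneg)
  have pos: "c + 2 * real s - 1 > 0" "Gamma (c + real s) > 0"
    using assms by (auto intro: Gamma_real_pos)
  define S where "S = (\<Sum>n=0..s. ?A n)"
  define T where "T = (\<Sum>n=0..s. real n * ?A n)"
  have S: "S = Gamma c * Gamma (c + 2 * real s) / (Gamma (c + real s))\<^sup>2"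
    unfolding S_def using \<open>c > 0\<close> by (rule sum_p_coeff)
  have T: "T = (real s)\<^sup>2 * Gamma c * Gamma (c + 2 * real s) /
      ((c + 2 * real s - 1) * (Gamma (c + real s))\<^sup>2)"
    unfolding T_def using \<open>c > 0\<close> \<open>s \<ge> 1\<close> by (rule sum_index_p_coeff)
  {
    assume "Gamma c * Gamma (c + 2 * real s) < lam * (Gamma (c + real s))\<^sup>2"
    then have "S < lam"
      using pos by (simp add: S pos_divide_less_eq)
    have f: "p1 s c \<eta> z = z + cnj (\<eta> * (\<Sum>n=0..s. of_real (?A n / real (n + 1)) * z ^ (n + 2)))" for z
      by (simp add: p1_def)
    have w: "?A n / real (n + 1) \<ge> 0" for n
      using A by simp
    \<comment> \<open>The weight k - 1 = n + 1 cancels the denominator, which leaves S.\<close>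
    have l: "(\<Sum>n=0..s. ?A n / real (n + 1) * real (n + 2 - 1)) < lam"
      using \<open>S < lam\<close> by (simp add: S_def add.commute)
    have "(\<Sum>n=0..s. ?A n / real (n + 1) * real (n + 2)) \<le> 2 * S"
      unfolding S_def sum_distrib_left
    proof (rule sum_mono)
      fix n
      assume "n \<in> {0..s}"
      then have "?A n * (real n + 2) \<le> ?A n * (2 * (real n + 1))"
        by (intro mult_left_mono A) auto
      then show "?A n / real (n + 1) * real (n + 2) \<le> 2 * ?A n"
        by (simp add: field_simps)
    qed
    also have "\<dots> < 2 * lam"
      using \<open>S < lam\<close> by simp
    finally have L: "(\<Sum>n=0..s. ?A n / real (n + 1) * real (n + 2)) < 2 * lam" .
    note * = harmonic_poly_class_and_inj[OF f w _ \<eta> l]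
    show "p1 s c \<eta> \<in> Omega_H0 lam"
      using *(1) by (simp add: Omega_H0_def)
    show "inj_on (p1 s c \<eta>) \<D>" if "2 * lam * norm \<eta> \<le> 1"
      using *(2)[OF _ L that] by simp
  }
  {
    assume "(real s)\<^sup>2 * Gamma c * Gamma (c + 2 * real s)
        < lam * (c + 2 * real s - 1) * (Gamma (c + real s))\<^sup>2"
    then have "T < lam"
      using pos by (simp add: T pos_divide_less_eq mult.assoc)
    have l: "(\<Sum>n=0..s. ?A n * real (n + 1 - 1)) < lam"
      using \<open>T < lam\<close> by (simp add: T_def mult.commute)
    \<comment> \<open>Without the linear term the sum starts at n = 1; shifting the index gives the
      case m = 2. T is unchanged, as its term n = 0 is zero.\<close>
    obtain t where t: "s = Suc t"
      using \<open>s \<ge> 1\<close> by (cases s) auto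
    have T': "T = (\<Sum>n=0..t. ?A (Suc n) * real (n + 2 - 1))"
      unfolding T_def t by (subst sum.atLeast0_atMost_Suc_shift) (simp add: mult.commute)
    have f': "p2_normalized s c \<eta> z =
        z + cnj (\<eta> * (\<Sum>n=0..t. of_real (?A (Suc n)) * z ^ (n + 2)))" for z
      unfolding p2_normalized_def t One_nat_def sum.shift_bounds_cl_Suc_ivl by simp
    have l': "(\<Sum>n=0..t. ?A (Suc n) * real (n + 2 - 1)) < lam"
      using \<open>T < lam\<close> by (simp only: T')
    have "(\<Sum>n=0..t. ?A (Suc n) * real (n + 2)) \<le> 2 * T"
      unfolding T' sum_distrib_left
    proof (rule sum_mono)
      fix n
      assume "n \<in> {0..t}"
      then have "?A (Suc n) * real (n + 2) \<le> ?A (Suc n) * (2 * real (n + 2 - 1))"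
        by (intro mult_left_mono A) auto
      then show "?A (Suc n) * real (n + 2) \<le> 2 * (?A (Suc n) * real (n + 2 - 1))"
        by (simp only: mult.left_commute)
    qed
    then have L': "(\<Sum>n=0..t. ?A (Suc n) * real (n + 2)) < 2 * lam"
      using \<open>T < lam\<close> by linarith
    \<comment> \<open>The linear term has k = 1, where k \<le> 2 (k - 1) fails; it is split off and
      accounts for the 1 in 1 + 2 lam.\<close>
    have "(\<Sum>n=0..s. ?A n * real (n + 1)) = 1 + (\<Sum>n=0..t. ?A (Suc n) * real (n + 2))"
      unfolding t by (subst sum.atLeast0_atMost_Suc_shift) simp
    with L' have L: "(\<Sum>n=0..s. ?A n * real (n + 1)) < 1 + 2 * lam"
      by simp
    note * = harmonic_poly_class_and_inj[OF p2_def A _ \<eta> l]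
    show "p2 s c \<eta> \<in> Omega_H lam"
      using *(1) by (simp add: Omega_H_def)
    show "inj_on (p2 s c \<eta>) \<D>" if "(1 + 2 * lam) * norm \<eta> \<le> 1"
      using *(2)[OF _ L that] by simp
    note ** = harmonic_poly_class_and_inj[OF f' A _ \<eta> l']
    show "p2_normalized s c \<eta> \<in> Omega_H0 lam"
      using **(1) by (simp add: Omega_H0_def)
    show "inj_on (p2_normalized s c \<eta>) \<D>" if "2 * lam * norm \<eta> \<le> 1"
      using **(2)[OF _ L' that] by simp
  }
  {
    assume hyp: "(c + (real s)\<^sup>2 + 2 * real s - 1) * Gamma c * Gamma (c + 2 * real s)
        < lam * (c + 2 * real s - 1) * (Gamma (c + real s))\<^sup>2"
    \<comment> \<open>Over the common denominator S contributes c + 2s - 1 and T contributes s^2.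
      The sum is relevant because the weight k - 1 is n + 1 here.\<close>
    have "S + T = (c + (real s)\<^sup>2 + 2 * real s - 1) * Gamma c * Gamma (c + 2 * real s) /
        ((c + 2 * real s - 1) * (Gamma (c + real s))\<^sup>2)"
      using pos unfolding S T by (simp add: divide_simps) (simp add: algebra_simps)
    with hyp pos have "S + T < lam"
      by (simp add: pos_divide_less_eq mult.assoc)
    have ST: "S + T = (\<Sum>n=0..s. ?A n * real (n + 2 - 1))"
      unfolding S_def T_def sum.distrib[symmetric] by (simp add: algebra_simps)
    have l: "(\<Sum>n=0..s. ?A n * real (n + 2 - 1)) < lam"
      using \<open>S + T < lam\<close> by (simp only: ST)
    have "(\<Sum>n=0..s. ?A n * real (n + 2)) \<le> 2 * (S + T)"
      unfolding ST sum_distrib_left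
    proof (rule sum_mono)
      fix n
      assume "n \<in> {0..s}"
      then have "?A n * real (n + 2) \<le> ?A n * (2 * real (n + 2 - 1))"
        by (intro mult_left_mono A) auto
      then show "?A n * real (n + 2) \<le> 2 * (?A n * real (n + 2 - 1))"
        by (simp only: mult.left_commute)
    qed
    also have "\<dots> < 2 * lam"
      using \<open>S + T < lam\<close> by simp
    finally have L: "(\<Sum>n=0..s. ?A n * real (n + 2)) < 2 * lam" .
    note * = harmonic_poly_class_and_inj[OF p3_def A _ \<eta> l]
    show "p3 s c \<eta> \<in> Omega_H0 lam"
      using *(1) by (simp add: Omega_H0_def)
    show "inj_on (p3 s c \<eta>) \<D>" if "2 * lam * norm \<eta> \<le> 1"
      using *(2)[OF _ L that] by simp
  }
qed

end
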